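(* Let $\mathcal H$ be a real Hilbert space and let $f\in\Gamma_0(\mathcal H)$. Then the following are equivalent: (i) $f$ is almost strictly convex. (ii) $\partial f$ is strictly monotone on any convex subset of $\operatorname{dom}\partial f$. (iii) $\partial f$ is strictly monotone.
   Context: $\Gamma_0(\mathcal H)$ is the set of proper, lower semicontinuous, convex functions $f:\mathcal H\to\left]-\infty,+\infty\right]$. The subdifferential of $f$ is $\partial f(x)=\{v\in\mathcal H : f(y)\ge f(x)+\langle v,y-x\rangle\ \forall y\in\mathcal H\}$ and $\operatorname{dom}\partial f=\{x:\partial f(x)\neq\varnothing\}$ (not necessarily convex). A function $f\in\Gamma_0(\mathcal H)$ is almost strictly convex if it is strictly convex along every line segment contained in $\operatorname{dom}\partial f$, i.e. for all $x_0\ne x_1$ with $[x_0,x_1]\subseteq\operatorname{dom}\partial f$ the restriction of $f$ to $[x_0,x_1]$ is strictly convex. A set-valued operator $A:\mathcal H\to 2^{\mathcal H}$ is strictly monotone on a set $S$ if $\langle x_0-x_1,v_0-v_1\rangle>0$ whenever $x_0,x_1\in S$, $x_0\neq x_1$, $v_i\in Ax_i$ ($i=0,1$); it is strictly monotone if this holds with $S=\mathcal H$. *)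

theory Defs
  imports "HOL-Analysis.Analysis"
begin

definition proper_fun :: "('a \<Rightarrow> ereal) \<Rightarrow> bool" where
  "proper_fun f \<longleftrightarrow> (\<forall>x. f x \<noteq> -\<infinity>) \<and> (\<exists>x. f x \<noteq> \<infinity>)"

text \<open>The filter \<^term>\<open>at x\<close> omits \<open>x\<close> itself; in an inequality with \<open>f x\<close> this makes no difference.\<close>

definition lower_semicontinuous :: "('a::topological_space \<Rightarrow> ereal) \<Rightarrow> bool" where
  "lower_semicontinuous f \<longleftrightarrow> (\<forall>x. f x \<le> Liminf (at x) f)"

text \<open>The library's \<^term>\<open>convex_on\<close> is restricted to real-valued functions. For functions that
  never take the value \<open>-\<infinity>\<close>, no sum \<open>\<infinity> - \<infinity>\<close> arises on
  the right-hand sides below.\<close>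

definition convex_fun :: "('a::real_vector \<Rightarrow> ereal) \<Rightarrow> bool" where
  "convex_fun f \<longleftrightarrow>
     (\<forall>x y. \<forall>t::real. 0 < t \<and> t < 1 \<longrightarrow>
        f ((1 - t) *\<^sub>R x + t *\<^sub>R y) \<le> ereal (1 - t) * f x + ereal t * f y)"

definition strictly_convex_on :: "'a::real_vector set \<Rightarrow> ('a \<Rightarrow> ereal) \<Rightarrow> bool" where
  "strictly_convex_on S f \<longleftrightarrow>
     (\<forall>x\<in>S. \<forall>y\<in>S. \<forall>t::real. x \<noteq> y \<and> 0 < t \<and> t < 1 \<longrightarrow>
        f ((1 - t) *\<^sub>R x + t *\<^sub>R y) < ereal (1 - t) * f x + ereal t * f y)"

definition Gamma0 :: "('a::real_normed_vector \<Rightarrow> ereal) set" where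
  "Gamma0 = {f. proper_fun f \<and> lower_semicontinuous f \<and> convex_fun f}"

definition subdifferential :: "('a::real_inner \<Rightarrow> ereal) \<Rightarrow> 'a \<Rightarrow> 'a set" where
  "subdifferential f x = {v. \<forall>y. f y \<ge> f x + ereal (v \<bullet> (y - x))}"

definition op_domain :: "('a \<Rightarrow> 'b set) \<Rightarrow> 'a set" where
  "op_domain A = {x. A x \<noteq> {}}"

definition almost_strictly_convex :: "('a::real_inner \<Rightarrow> ereal) \<Rightarrow> bool" where
  "almost_strictly_convex f \<longleftrightarrow>
     (\<forall>x0 x1. x0 \<noteq> x1 \<and> closed_segment x0 x1 \<subseteq> op_domain (subdifferential f) \<longrightarrow>
        strictly_convex_on (closed_segment x0 x1) f)"

definition strictly_monotone_on :: "'a::real_inner set \<Rightarrow> ('a \<Rightarrow> 'a set) \<Rightarrow> bool" where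
  "strictly_monotone_on S A \<longleftrightarrow>
     (\<forall>x0\<in>S. \<forall>x1\<in>S. \<forall>v0\<in>A x0. \<forall>v1\<in>A x1.
        x0 \<noteq> x1 \<longrightarrow> (x0 - x1) \<bullet> (v0 - v1) > 0)"

abbreviation strictly_monotone :: "('a::real_inner \<Rightarrow> 'a set) \<Rightarrow> bool" where
  "strictly_monotone A \<equiv> strictly_monotone_on UNIV A"

end

theory Submission
  imports Defs
begin

text \<open>Everything rests on one fact: if \<open>v\<close> is a subgradient at \<open>x\<close> and \<open>f\<close> coincides at \<open>y\<close> with the
  affine minorant of slope \<open>v\<close> through \<open>(x, f x)\<close>, then \<open>v\<close> is a subgradient at \<open>y\<close> as well.
  If strict monotonicity fails at \<open>x0 \<noteq> x1\<close>, the two subgradient inequalities are equalities, so one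
  vector is a subgradient on the whole segment, which makes \<open>f\<close> affine there. Conversely, if strict
  convexity fails at an inner point \<open>z\<close> of a segment, any subgradient at \<open>z\<close> is also one at the
  end points.\<close>

lemma subdifferential_transfer:
  assumes v: "v \<in> subdifferential f x" and y: "f y \<le> f x + ereal (v \<bullet> (y - x))"
  shows "v \<in> subdifferential f y"
  unfolding subdifferential_def
proof (intro CollectI allI)
  fix w
  have "f y + ereal (v \<bullet> (w - y)) \<le> f x + ereal (v \<bullet> (y - x)) + ereal (v \<bullet> (w - y))"
    using y by (rule add_right_mono)
  also have "\<dots> = f x + ereal (v \<bullet> (w - x))"
    by (simp add: add.assoc inner_diff_right)
  also have "\<dots> \<le> f w"
    using v by (simp add: subdifferential_def)
  finally show "f y + ereal (v \<bullet> (w - y)) \<le> f w" .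
qed

text \<open>Testing the subgradient inequality at a point where \<open>f\<close> is finite excludes
  \<open>f x = \<infinity>\<close>. This lets the later estimates be done in real
  arithmetic.\<close>

lemma proper_fun_subdifferential_finite:
  assumes "proper_fun f" and v: "v \<in> subdifferential f x"
  obtains r where "f x = ereal r"
proof -
  obtain y where "f y \<noteq> \<infinity>"
    using assms(1) by (auto simp: proper_fun_def)
  moreover have "f x + ereal (v \<bullet> (y - x)) \<le> f y"
    using v by (simp add: subdifferential_def)
  moreover have "f x \<noteq> -\<infinity>"
    using assms(1) by (simp add: proper_fun_def)
  ultimately show thesis
    using that by (cases "f x") auto
qed

text \<open>The inequality of \<open>v1\<close> gives
  \<open>f x1 \<le> f x0 + v1 \<bullet> (x1 - x0)\<close>, and \<open>le\<close> allows
  \<open>v1\<close> to be replaced by \<open>v0\<close> on the right, so the transfer lemma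
  applies.\<close>

lemma subdifferential_common_if_not_strictly_monotone:
  assumes pf: "proper_fun f"
    and v0: "v0 \<in> subdifferential f x0" and v1: "v1 \<in> subdifferential f x1"
    and le: "(x0 - x1) \<bullet> (v0 - v1) \<le> 0"
  shows "v0 \<in> subdifferential f x1"
proof (rule subdifferential_transfer[OF v0])
  obtain r0 r1 where r: "f x0 = ereal r0" "f x1 = ereal r1"
    using proper_fun_subdifferential_finite[OF pf] v0 v1 by metis
  have "f x1 + ereal (v1 \<bullet> (x0 - x1)) \<le> f x0"
    using v1 by (simp add: subdifferential_def)
  with r le show "f x1 \<le> f x0 + ereal (v0 \<bullet> (x1 - x0))"
    by (simp add: inner_diff_left inner_diff_right inner_commute)
qed

text \<open>With \<open>v\<close> in both images the inner product is
  \<open>(x - y) \<bullet> (v - v) = 0\<close>.\<close>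

lemma strictly_monotone_on_disjoint:
  assumes "strictly_monotone_on S A" "x \<in> S" "y \<in> S" "v \<in> A x" "v \<in> A y"
  shows "x = y"
  using assms by (force simp: strictly_monotone_on_def)

text \<open>The inequalities of \<open>v\<close> at both ends force
  \<open>f x1 - f x0 = v \<bullet> (x1 - x0)\<close>, so the chord is the affine minorant of slope
  \<open>v\<close>. Convexity puts \<open>f z\<close> below it, the subgradient inequality above
  it.\<close>

lemma subdifferential_common_segment:
  assumes pf: "proper_fun f" and cf: "convex_fun f"
    and v0: "v \<in> subdifferential f x0" and v1: "v \<in> subdifferential f x1"
    and t: "0 < t" "t < 1"
  defines "z \<equiv> (1 - t) *\<^sub>R x0 + t *\<^sub>R x1"
  shows "v \<in> subdifferential f z"
    and "ereal (1 - t) * f x0 + ereal t * f x1 \<le> f z"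
proof -
  obtain r0 r1 where r: "f x0 = ereal r0" "f x1 = ereal r1"
    using proper_fun_subdifferential_finite[OF pf] v0 v1 by metis
  have zx: "z - x0 = t *\<^sub>R (x1 - x0)"
    by (simp add: z_def algebra_simps)
  have "f x0 + ereal (v \<bullet> (x1 - x0)) \<le> f x1" "f x1 + ereal (v \<bullet> (x0 - x1)) \<le> f x0"
    using v0 v1 by (simp_all add: subdifferential_def)
  then have slope: "r1 - r0 = v \<bullet> (x1 - x0)"
    using r by (simp add: inner_diff_right)
  have combo: "ereal (1 - t) * f x0 + ereal t * f x1 = f x0 + ereal (v \<bullet> (z - x0))"
    unfolding zx inner_scaleR_right slope[symmetric] using r by (simp add: algebra_simps)
  have "f z \<le> ereal (1 - t) * f x0 + ereal t * f x1"
    using cf t by (simp add: convex_fun_def z_def)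
  with combo show "v \<in> subdifferential f z"
    by (intro subdifferential_transfer[OF v0]) simp
  show "ereal (1 - t) * f x0 + ereal t * f x1 \<le> f z"
    using v0 combo by (simp add: subdifferential_def)
qed

lemma almost_strictly_convex_imp_strictly_monotone:
  assumes pf: "proper_fun f" and cf: "convex_fun f" and asc: "almost_strictly_convex f"
  shows "strictly_monotone (subdifferential f)"
  unfolding strictly_monotone_on_def
proof (intro ballI impI, rule ccontr)
  fix x0 x1 v0 v1
  assume v: "v0 \<in> subdifferential f x0" "v1 \<in> subdifferential f x1" and "x0 \<noteq> x1"
    and "\<not> 0 < (x0 - x1) \<bullet> (v0 - v1)"
  then have v': "v0 \<in> subdifferential f x1"
    by (intro subdifferential_common_if_not_strictly_monotone[OF pf v]) simp
  note seg = subdifferential_common_segment[OF pf cf v(1) v']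
  have "closed_segment x0 x1 \<subseteq> op_domain (subdifferential f)"
  proof
    fix z assume "z \<in> closed_segment x0 x1"
    then obtain u where u: "0 \<le> u" "u \<le> 1" "z = (1 - u) *\<^sub>R x0 + u *\<^sub>R x1"
      by (auto simp: in_segment)
    \<comment> \<open>The end points are separated because \<open>seg\<close> covers only parameters
      strictly between 0 and 1.\<close>
    then consider "z = x0" | "z = x1" | "0 < u" "u < 1"
      by (cases "u = 0"; cases "u = 1") auto
    then have "v0 \<in> subdifferential f z"
      using v(1) v' seg(1)[of u] u(3) by cases simp_all
    then show "z \<in> op_domain (subdifferential f)"
      by (auto simp: op_domain_def)
  qed
  with asc \<open>x0 \<noteq> x1\<close> have "strictly_convex_on (closed_segment x0 x1) f"
    by (simp add: almost_strictly_convex_def)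
  \<comment> \<open>The midpoint serves as the inner point where the strict inequality contradicts
    \<open>seg(2)\<close>.\<close>
  then have "f ((1 - 1/2) *\<^sub>R x0 + (1/2) *\<^sub>R x1) < ereal (1 - 1/2) * f x0 + ereal (1/2) * f x1"
    by (rule strictly_convex_on_def[THEN iffD1, rule_format]) (simp_all add: \<open>x0 \<noteq> x1\<close>)
  moreover have "ereal (1 - 1/2) * f x0 + ereal (1/2) * f x1 \<le> f ((1 - 1/2) *\<^sub>R x0 + (1/2) *\<^sub>R x1)"
    by (rule seg(2)) simp_all
  ultimately show False
    by (meson leD)
qed

lemma strictly_monotone_on_imp_strictly_convex_on:
  assumes pf: "proper_fun f" and "convex C" and dom: "C \<subseteq> op_domain (subdifferential f)"
    and sm: "strictly_monotone_on C (subdifferential f)"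
  shows "strictly_convex_on C f"
  unfolding strictly_convex_on_def
proof (intro ballI allI impI, rule ccontr)
  fix x y and t :: real
  assume x: "x \<in> C" and y: "y \<in> C" and t: "x \<noteq> y \<and> 0 < t \<and> t < 1"
  define z where "z = (1 - t) *\<^sub>R x + t *\<^sub>R y"
  assume "\<not> f ((1 - t) *\<^sub>R x + t *\<^sub>R y) < ereal (1 - t) * f x + ereal t * f y"
  then have ge: "ereal (1 - t) * f x + ereal t * f y \<le> f z"
    by (simp add: z_def)
  have z: "z \<in> C"
    using \<open>convex C\<close> x y t by (simp add: z_def convexD_alt)
  obtain v where v: "v \<in> subdifferential f z"
    using z dom by (auto simp: op_domain_def)
  obtain rx ry rz where r: "f x = ereal rx" "f y = ereal ry" "f z = ereal rz"
    using proper_fun_subdifferential_finite[OF pf] x y z dom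
    by (metis (mono_tags) ex_in_conv mem_Collect_eq op_domain_def subsetD)
  have zx: "x - z = (- t) *\<^sub>R (y - x)" and zy: "y - z = (1 - t) *\<^sub>R (y - x)"
    by (simp_all add: z_def algebra_simps)
  have "f z + ereal (v \<bullet> (y - z)) \<le> f y"
    using v by (simp add: subdifferential_def)
  \<comment> \<open>Scaling by \<open>t\<close> lets \<open>t * ry\<close> be eliminated from
    \<open>ge\<close>, which leaves an upper bound for \<open>(1 - t) * rx\<close>.\<close>
  then have "t * (rz + (1 - t) * (v \<bullet> (y - x))) \<le> t * ry"
    using t r by (simp add: zy)
  with ge r have "(1 - t) * rx \<le> (1 - t) * (rz - t * (v \<bullet> (y - x)))"
    by (simp add: algebra_simps)
  then have "rx \<le> rz - t * (v \<bullet> (y - x))"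
    using t by simp
  then have "f x \<le> f z + ereal (v \<bullet> (x - z))"
    using r by (simp only: zx) simp
  then have "v \<in> subdifferential f x"
    by (rule subdifferential_transfer[OF v])
  \<comment> \<open>One end point is enough: \<open>v\<close> is a common subgradient at
    \<open>x\<close> and \<open>z\<close>, which differ since \<open>t > 0\<close> and
    \<open>x \<noteq> y\<close>.\<close>
  then have "x = z"
    using strictly_monotone_on_disjoint[OF sm x z] v by blast
  then show False
    using zx t by simp
qed

theorem theorem5p3:
  fixes f :: "'a::{real_inner, complete_space} \<Rightarrow> ereal"
  assumes "f \<in> Gamma0"
  shows "(almost_strictly_convex f \<longleftrightarrow>
            (\<forall>C. convex C \<and> C \<subseteq> op_domain (subdifferential f) \<longrightarrow>
                 strictly_monotone_on C (subdifferential f))) \<and>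
         ((\<forall>C. convex C \<and> C \<subseteq> op_domain (subdifferential f) \<longrightarrow>
                 strictly_monotone_on C (subdifferential f)) \<longleftrightarrow>
            strictly_monotone (subdifferential f))"
    (is "(?i \<longleftrightarrow> ?ii) \<and> (?ii \<longleftrightarrow> ?iii)")
proof -
  have pf: "proper_fun f" and cf: "convex_fun f"
    using assms by (auto simp: Gamma0_def)
  have "?iii" if "?i"
    using almost_strictly_convex_imp_strictly_monotone[OF pf cf that] .
  moreover have "?ii" if "?iii"
    using that by (auto simp: strictly_monotone_on_def)
  \<comment> \<open>The convex set \<open>C\<close> is taken to be the segment itself.\<close>
  moreover have "?i" if "?ii"
    unfolding almost_strictly_convex_def
    using that strictly_monotone_on_imp_strictly_convex_on[OF pf] convex_closed_segment by blast
  ultimately show ?thesis by blast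
qed

end
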